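(* Let $\Omega$ be a hyperbolic convex domain in $\mathbb{C}^n$. Then $\Omega$ is uniformly dominated by the Kobayashi-Royden metric $K_\Omega$. Indeed, $$B_\Omega(x;r)-x\subset 2\lambda_{\mathcal H}(r)\, I_\Omega(x)$$ for each $r>0$ and $x\in\Omega$, where $\lambda_{\mathcal H}(r)=\dfrac{\tanh(r/2)}{1-\tanh(r/2)}$.
   Context: The Kobayashi-Royden metric of a domain $\Omega\subset\mathbb{C}^n$ is $$K_\Omega(x;v)=\inf\{\lambda>0: \exists f\in\mathcal{O}(\Delta,\Omega),\ f(0)=x,\ \lambda f'(0)=v\},$$ where $\mathcal{O}(\Delta,\Omega)$ is the set of holomorphic maps from the unit disc $\Delta\subset\mathbb{C}$ into $\Omega$. A (complex Finsler) metric on $\Omega$ is an upper semicontinuous function $F$ on $\Omega\times\mathbb{C}^n$ with $F\ge 0$, $F(x;v)=0$ only if $v=0$, and $F(x;cv)=|c|F(x;v)$ for $c\in\mathbb{C}$. The domain $\Omega$ is hyperbolic if $K_\Omega$ is a metric in this sense. For a metric $F$ on $\Omega$: the indicatrix is $I_{\Omega,F}(x)=\{v\in\mathbb{C}^n:F(x;v)<1\}$; the induced distance is $d_{\Omega,F}(x,y)=\inf\int_0^1F(c(t);c'(t))\,dt$, the infimum over piecewise differentiable real curves $c:[0,1]\to\Omega$ joining $x$ and $y$; the ball is $B_{\Omega,F}(x;r)=\{y\in\Omega:d_{\Omega,F}(x,y)<r\}$; and $B_{\Omega,F}(x;r)-x=\{y-x:y\in B_{\Omega,F}(x;r)\}$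 is its Euclidean translate. For $F=K_\Omega$ write $I_\Omega(x)$ and $B_\Omega(x;r)$. $\Omega$ is uniformly dominated by $F$ if $d_{\Omega,F}$ is Cauchy complete and for each $r>0$ there is $\lambda(r)>0$ such that $B_{\Omega,F}(x;r)-x\subset\lambda(r)I_{\Omega,F}(x)$ for all $x\in\Omega$.
   Formalization: The constant is λ_H(r) = tanh(r)/(1 − tanh(r)) instead of the printed one with tanh(r/2), since with K_Ω as defined (curvature −4) the printed inclusion fails on the right half-plane at x = 1 for every r > 0. *)

theory Defs
  imports "HOL-Analysis.Analysis"
begin

definition complex_domain :: "(complex^'n) set \<Rightarrow> bool"
  where "complex_domain \<Omega> \<longleftrightarrow> open \<Omega> \<and> connected \<Omega> \<and> \<Omega> \<noteq> {}"

definition holo_discs :: "(complex^'n) set \<Rightarrow> (complex \<Rightarrow> complex^'n) set"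
  where "holo_discs \<Omega> =
    {f. (\<forall>i. (\<lambda>z. f z $ i) holomorphic_on ball 0 1) \<and> f ` ball 0 1 \<subseteq> \<Omega>}"

definition cderiv :: "(complex \<Rightarrow> complex^'n) \<Rightarrow> complex \<Rightarrow> complex^'n"
  where "cderiv f z = (\<chi> i. deriv (\<lambda>w. f w $ i) z)"

definition kobayashi_royden :: "(complex^'n) set \<Rightarrow> complex^'n \<Rightarrow> complex^'n \<Rightarrow> real"
  where "kobayashi_royden \<Omega> x v =
    Inf {l. l > 0 \<and> (\<exists>f \<in> holo_discs \<Omega>. f 0 = x \<and> l *\<^sub>R cderiv f 0 = v)}"

text \<open>The first conjunct is upper semicontinuity on \<open>\<Omega> \<times> \<complex>\<^sup>n\<close>.\<close>

definition finsler_metric ::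
    "(complex^'n) set \<Rightarrow> (complex^'n \<Rightarrow> complex^'n \<Rightarrow> real) \<Rightarrow> bool"
  where "finsler_metric \<Omega> F \<longleftrightarrow>
    (\<forall>x\<in>\<Omega>. \<forall>v a. F x v < a \<longrightarrow>
       (\<forall>\<^sub>F p in at (x, v) within \<Omega> \<times> UNIV. F (fst p) (snd p) < a)) \<and>
    (\<forall>x\<in>\<Omega>. \<forall>v. F x v \<ge> 0) \<and>
    (\<forall>x\<in>\<Omega>. \<forall>v. F x v = 0 \<longrightarrow> v = 0) \<and>
    (\<forall>x\<in>\<Omega>. \<forall>v c. F x (c *s v) = cmod c * F x v)"

definition hyperbolic :: "(complex^'n) set \<Rightarrow> bool"
  where "hyperbolic \<Omega> \<longleftrightarrow> finsler_metric \<Omega> (kobayashi_royden \<Omega>)"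

definition indicatrix ::
    "(complex^'n \<Rightarrow> complex^'n \<Rightarrow> real) \<Rightarrow> complex^'n \<Rightarrow> (complex^'n) set"
  where "indicatrix F x = {v. F x v < 1}"

text \<open>
  Curves along which the nonnegative integrand is not integrable have infinite length and do
  not affect the infimum; the finitely many times at which the curve need not be differentiable
  do not affect the integral. If \<open>\<Omega>\<close> is a domain and \<open>F\<close> a metric, the set of lengths is
  nonempty for all \<open>x, y \<in> \<Omega>\<close>.
\<close>

definition curve_lengths ::
    "(complex^'n) set \<Rightarrow> (complex^'n \<Rightarrow> complex^'n \<Rightarrow> real) \<Rightarrow>
       complex^'n \<Rightarrow> complex^'n \<Rightarrow> real set"
  where "curve_lengths \<Omega> F x y =
    {L. \<exists>c. c piecewise_differentiable_on {0..1} \<and> c ` {0..1} \<subseteq> \<Omega> \<and> c 0 = x \<and> c 1 = y \<and>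
        ((\<lambda>t. F (c t) (vector_derivative c (at t))) has_integral L) {0..1}}"

text \<open>
  The value \<open>0\<close> outside \<open>\<Omega>\<close> is a convention: \<^locale>\<open>Metric_space\<close> asks for nonnegativity
  everywhere, whereas \<open>Inf {}\<close> is unspecified on the reals.
\<close>

definition finsler_dist ::
    "(complex^'n) set \<Rightarrow> (complex^'n \<Rightarrow> complex^'n \<Rightarrow> real) \<Rightarrow>
       complex^'n \<Rightarrow> complex^'n \<Rightarrow> real"
  where "finsler_dist \<Omega> F x y =
    (if x \<in> \<Omega> \<and> y \<in> \<Omega> then Inf (curve_lengths \<Omega> F x y) else 0)"

definition finsler_ball ::
    "(complex^'n) set \<Rightarrow> (complex^'n \<Rightarrow> complex^'n \<Rightarrow> real) \<Rightarrow>
       complex^'n \<Rightarrow> real \<Rightarrow> (complex^'n) set"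
  where "finsler_ball \<Omega> F x r = {y \<in> \<Omega>. finsler_dist \<Omega> F x y < r}"

definition uniformly_dominated ::
    "(complex^'n) set \<Rightarrow> (complex^'n \<Rightarrow> complex^'n \<Rightarrow> real) \<Rightarrow> bool"
  where "uniformly_dominated \<Omega> F \<longleftrightarrow>
    finsler_metric \<Omega> F \<and>
    Metric_space \<Omega> (finsler_dist \<Omega> F) \<and>
    Metric_space.mcomplete \<Omega> (finsler_dist \<Omega> F) \<and>
    (\<forall>r>0. \<exists>l>0. \<forall>x\<in>\<Omega>.
       (\<lambda>y. y - x) ` finsler_ball \<Omega> F x r \<subseteq> (\<lambda>v. l *\<^sub>R v) ` indicatrix F x)"

text \<open>
  \<open>kobayashi_royden\<close> is normalised by \<open>K(0; v) = \<bar>v\<bar>\<close> on the unit disc (curvature \<open>-4\<close>), so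
  \<open>d(0, z) = artanh \<bar>z\<bar>\<close> there, and on the right half-plane \<open>K(z; v) = \<bar>v\<bar> / (2 Re z)\<close>.
  The ball of radius \<open>r\<close> about \<open>1\<close> in the half-plane then meets the real axis in
  \<open>(exp (- 2 r), exp (2 r))\<close>, the indicatrix at \<open>1\<close> is the disc of radius \<open>2\<close>, and the
  least dilation constant is \<open>(exp (2 r) - 1) / 2 = tanh r / (1 - tanh r)\<close>.

  The constant also appears in the form with \<open>tanh (r / 2)\<close>. That belongs to the distance of
  curvature \<open>-1\<close>, which is twice the one used here; with the present distance the inclusion
  with constant \<open>2 tanh (r / 2) / (1 - tanh (r / 2)) = exp r - 1\<close> fails for the half-plane,
  for every \<open>r > 0\<close>.
\<close>

definition lambda_H :: "real \<Rightarrow> real"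
  where "lambda_H r = tanh r / (1 - tanh r)"

end

theory Submission
  imports Defs "HOL-Complex_Analysis.Conformal_Mappings"
begin

text \<open>
  A point \<open>p\<close> outside the convex domain \<open>\<Omega>\<close> is separated from it by a hyperplane, which gives a
  complex affine map \<open>g\<close> from \<open>\<Omega>\<close> to the right half-plane with \<open>g p = 0\<close>. By the Schwarz-Pick
  lemma \<open>g\<close> does not increase Kobayashi-Royden lengths, so
  \<open>\<bar>g y - g x\<bar> \<le> (exp (2 r) - 1) Re (g x)\<close> whenever \<open>d(x, y) < r\<close>. If \<open>p = x + \<zeta> (y - x)\<close>, then
  \<open>g x = - \<zeta> (g y - g x)\<close>, and hence \<open>\<bar>\<zeta>\<bar> \<ge> 1 / (exp (2 r) - 1)\<close>. So \<open>\<Omega>\<close> contains the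
  corresponding disc in the complex line through \<open>x\<close> and \<open>y\<close>, and
  \<open>K(x; y - x) < exp (2 r) - 1 = 2 tanh r / (1 - tanh r)\<close>. The same estimate makes \<open>g\<close> converge
  along a Cauchy sequence, with a limit off the imaginary axis. As \<open>\<Omega>\<close> contains no complex line,
  the linear parts of all these maps span the dual space, so Cauchy sequences converge in \<open>\<Omega>\<close>.
\<close>

section \<open>Complex linear forms attached to real hyperplanes\<close>

text \<open>The Hermitian pairing, conjugated in \<open>a\<close> so that its real part is
  \<open>a \<bullet> z\<close>. A real separating functional thus becomes the real part of a complex
  linear form.\<close>

definition cform :: "complex^'n \<Rightarrow> complex^'n \<Rightarrow> complex"
  where "cform a z = (\<Sum>i\<in>UNIV. cnj (a $ i) * z $ i)"

lemma cform_diff: "cform a (x - y) = cform a x - cform a y"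
  by (simp add: cform_def right_diff_distrib sum_subtractf)

lemma cform_scale: "cform a (c *s x) = c * cform a x"
  by (simp add: cform_def sum_distrib_left mult_ac)

lemma scaleR_eq_scale: "r *\<^sub>R (v :: complex^'n) = of_real r *s v"
  by (simp add: vec_eq_iff scaleR_conv_of_real[where 'a = complex])

lemma Re_cform: "Re (cform a z) = a \<bullet> z"
  by (simp add: cform_def inner_vec_def inner_complex_def)

lemma Im_cform: "Im (cform a z) = (\<i> *s a) \<bullet> z"
  by (simp add: cform_def inner_vec_def inner_complex_def)

lemma linear_cform: "linear (cform a)"
  by (rule linearI) (simp_all add: cform_def distrib_left sum.distrib scaleR_sum_right)

section \<open>Half-plane estimates for the Kobayashi-Royden metric and for curve lengths\<close>

text \<open>A Cayley transform takes the right half-plane to the unit disc and \<open>g 0\<close> to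
  0. Its derivative at \<open>g 0\<close> is \<open>1 / (2 * Re (g 0))\<close>, so the Schwarz lemma
  for the composite \<open>w\<close> gives the bound.\<close>

lemma Schwarz_Pick_halfplane:
  assumes hol: "g holomorphic_on ball 0 1" and pos: "\<And>z. z \<in> ball 0 1 \<Longrightarrow> Re (g z) > 0"
  shows "cmod (deriv g 0) \<le> 2 * Re (g 0)"
proof -
  define w where "w = (\<lambda>z. (g z - g 0) / (g z + cnj (g 0)))"
  have pos0: "Re (g 0) > 0"
    using pos by simp
  have nz: "g z + cnj (g 0) \<noteq> 0" if "z \<in> ball 0 1" for z
    using pos[OF that] pos0 by (auto simp: complex_eq_iff)
  have "w holomorphic_on ball 0 1"
    unfolding w_def by (intro holomorphic_intros hol nz)
  moreover have "w 0 = 0"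
    by (simp add: w_def)
  moreover have "norm (w z) < 1" if "norm z < 1" for z
  proof -
    have z: "z \<in> ball 0 1"
      using that by simp
    \<comment> \<open>The squared moduli compared next differ by exactly four times this
      product.\<close>
    have "0 < Re (g z) * Re (g 0)"
      using pos[OF z] pos0 by simp
    then have "(cmod (g z - g 0))\<^sup>2 < (cmod (g z + cnj (g 0)))\<^sup>2"
      unfolding cmod_power2 by (simp add: power2_eq_square algebra_simps)
    then have "cmod (g z - g 0) < cmod (g z + cnj (g 0))"
      by (rule power2_less_imp_less) simp
    then show ?thesis
      using nz[OF z] by (simp add: w_def norm_divide)
  qed
  ultimately have "norm (deriv w 0) \<le> 1"
    by (intro Schwarz_Lemma(2)[where \<xi> = 0]) auto
  moreover have "deriv w 0 = deriv g 0 / of_real (2 * Re (g 0))"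
  proof -
    have g': "(g has_field_derivative deriv g 0) (at 0)"
      using hol by (auto intro: holomorphic_derivI)
    have nz0: "g 0 + cnj (g 0) \<noteq> 0"
      using nz by simp
    have eq: "g 0 + cnj (g 0) = of_real (2 * Re (g 0))"
      by (simp add: complex_eq_iff)
    have "(w has_field_derivative
        ((deriv g 0 * (g 0 + cnj (g 0)) - (g 0 - g 0) * deriv g 0)
          / ((g 0 + cnj (g 0)) * (g 0 + cnj (g 0))))) (at 0)"
      unfolding w_def using nz0 g' by (auto intro!: derivative_eq_intros)
    from DERIV_imp_deriv[OF this] have "deriv w 0 = deriv g 0 / (g 0 + cnj (g 0))"
      using nz0 by simp
    then show ?thesis
      unfolding eq .
  qed
  ultimately show ?thesis
    using pos0 by (simp add: norm_divide norm_mult)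
qed

text \<open>The competitor is the affine disc of radius \<open>R\<close> in direction
  \<open>v\<close>, whose derivative at the centre is \<open>R\<close> times
  \<open>v\<close>.\<close>

lemma linear_disc:
  fixes \<Omega> :: "(complex^'n) set"
  assumes "R > 0" and disc: "\<And>\<zeta>. cmod \<zeta> < R \<Longrightarrow> x + \<zeta> *s v \<in> \<Omega>"
  shows "\<exists>f\<in>holo_discs \<Omega>. f 0 = x \<and> (1 / R) *\<^sub>R cderiv f 0 = v"
proof (intro bexI conjI)
  define f where "f z = x + (of_real R * z) *s v" for z
  show "f \<in> holo_discs \<Omega>"
    using assms
    by (auto simp: holo_discs_def f_def norm_mult mult_less_cancel_left2 intro!: disc holomorphic_intros)
  show "f 0 = x"
    by (simp add: f_def)
  have "((\<lambda>z. f z $ i) has_field_derivative of_real R * v $ i) (at 0)" for i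
    by (auto simp: f_def intro!: derivative_eq_intros)
  then have "deriv (\<lambda>z. f z $ i) 0 = of_real R * v $ i" for i
    by (rule DERIV_imp_deriv)
  then show "(1 / R) *\<^sub>R cderiv f 0 = v"
    using \<open>R > 0\<close> by (simp add: vec_eq_iff cderiv_def scaleR_conv_of_real[where 'a = complex])
qed

lemma kobayashi_royden_le:
  fixes \<Omega> :: "(complex^'n) set"
  assumes "R > 0" and "\<And>\<zeta>. cmod \<zeta> < R \<Longrightarrow> x + \<zeta> *s v \<in> \<Omega>"
  shows "kobayashi_royden \<Omega> x v \<le> 1 / R"
  unfolding kobayashi_royden_def using linear_disc[OF assms] \<open>R > 0\<close>
  by (intro cInf_lower bdd_belowI[where m = 0]) force+

lemma ball_complex_line:
  fixes v :: "complex^'n"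
  assumes "ball x \<rho> \<subseteq> \<Omega>" "cmod \<zeta> * norm v < \<rho>"
  shows "x + \<zeta> *s v \<in> \<Omega>"
proof -
  have "norm (\<zeta> *s v) = cmod \<zeta> * norm v"
    by (simp add: norm_vec_def L2_set_right_distrib norm_mult)
  then show ?thesis
    using assms by (auto simp: dist_norm)
qed

text \<open>Provides a competing disc in every direction, so that the infimum defining the metric is
  over a nonempty set.\<close>

lemma open_complex_line:
  fixes \<Omega> :: "(complex^'n) set"
  assumes "open \<Omega>" "x \<in> \<Omega>"
  obtains R where "R > 0" "\<And>\<zeta>. cmod \<zeta> < R \<Longrightarrow> x + \<zeta> *s v \<in> \<Omega>"
proof -
  obtain \<rho> where \<rho>: "\<rho> > 0" "ball x \<rho> \<subseteq> \<Omega>"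
    using assms openE by blast
  show thesis
  proof (rule that)
    \<comment> \<open>Adding 1 to the norm covers \<open>v = 0\<close>.\<close>
    show "\<rho> / (norm v + 1) > 0"
      using \<rho>(1) by (simp add: add_nonneg_pos)
    fix \<zeta> assume "cmod \<zeta> < \<rho> / (norm v + 1)"
    then have "cmod \<zeta> * (norm v + 1) < \<rho>"
      by (simp add: pos_less_divide_eq add_nonneg_pos)
    then have "cmod \<zeta> * norm v < \<rho>"
      by (simp add: distrib_left) (smt (verit) norm_ge_zero)
    then show "x + \<zeta> *s v \<in> \<Omega>"
      by (rule ball_complex_line[OF \<rho>(2)])
  qed
qed

text \<open>Composing a competing disc with the affine map
  \<open>\<lambda>z. cform a (p - z)\<close> lands in the right half-plane. Schwarz-Pick bounds the
  derivative there, uniformly over all competitors, and so bounds their infimum.\<close>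

lemma kobayashi_royden_ge:
  fixes \<Omega> :: "(complex^'n) set"
  assumes \<Omega>: "open \<Omega>" "x \<in> \<Omega>" and sep: "\<And>z. z \<in> \<Omega> \<Longrightarrow> a \<bullet> z < a \<bullet> p"
  shows "cmod (cform a v) \<le> 2 * (a \<bullet> (p - x)) * kobayashi_royden \<Omega> x v"
proof -
  have pos: "a \<bullet> (p - x) > 0"
    using sep[OF \<Omega>(2)] by (simp add: inner_diff_right)
  have "cmod (cform a v) / (2 * (a \<bullet> (p - x))) \<le> kobayashi_royden \<Omega> x v"
    unfolding kobayashi_royden_def
  proof (rule cInf_greatest)
    show "{l. l > 0 \<and> (\<exists>f \<in> holo_discs \<Omega>. f 0 = x \<and> l *\<^sub>R cderiv f 0 = v)} \<noteq> {}"
    proof -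
      obtain R where R: "R > 0" "\<And>\<zeta>. cmod \<zeta> < R \<Longrightarrow> x + \<zeta> *s v \<in> \<Omega>"
        using open_complex_line[OF \<Omega>] by blast
      then have "1 / R > 0"
        by simp
      with linear_disc[OF R] show ?thesis
        by blast
    qed
  next
    fix l assume "l \<in> {l. l > 0 \<and> (\<exists>f \<in> holo_discs \<Omega>. f 0 = x \<and> l *\<^sub>R cderiv f 0 = v)}"
    then obtain f where l: "l > 0" and f: "f \<in> holo_discs \<Omega>" "f 0 = x" "l *\<^sub>R cderiv f 0 = v"
      by auto
    define g where "g z = cform a (p - f z)" for z
    have holf: "(\<lambda>z. f z $ i) holomorphic_on ball 0 1" for i
      using f(1) by (simp add: holo_discs_def)
    have "g holomorphic_on ball 0 1"
      unfolding g_def cform_def vector_minus_component by (intro holomorphic_intros holf)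
    moreover have "Re (g z) > 0" if "z \<in> ball 0 1" for z
    proof -
      have "f z \<in> \<Omega>"
        using f(1) that unfolding holo_discs_def by blast
      then show ?thesis
        by (simp add: g_def Re_cform inner_diff_right sep)
    qed
    ultimately have "cmod (deriv g 0) \<le> 2 * Re (g 0)"
      by (rule Schwarz_Pick_halfplane)
    moreover have "deriv g 0 = - cform a (cderiv f 0)"
    proof (rule DERIV_imp_deriv)
      have "((\<lambda>z. f z $ i) has_field_derivative cderiv f 0 $ i) (at 0)" for i
        using holomorphic_derivI[OF holf[of i], of 0] by (simp add: cderiv_def)
      then show "(g has_field_derivative - cform a (cderiv f 0)) (at 0)"
        unfolding g_def cform_def vector_minus_component
        by (auto intro!: derivative_eq_intros simp: sum_negf mult.commute)
    qed
    moreover have "Re (g 0) = a \<bullet> (p - x)"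
      by (simp add: g_def Re_cform f)
    ultimately have *: "cmod (cform a (cderiv f 0)) \<le> 2 * (a \<bullet> (p - x))"
      by simp
    have "cmod (cform a v) = l * cmod (cform a (cderiv f 0))"
      using l by (simp add: f(3)[symmetric] scaleR_eq_scale cform_scale norm_mult)
    also have "\<dots> \<le> l * (2 * (a \<bullet> (p - x)))"
      using * l by (intro mult_left_mono) auto
    finally show "cmod (cform a v) / (2 * (a \<bullet> (p - x))) \<le> l"
      using pos by (simp add: field_simps)
  qed
  then show ?thesis
    using pos by (simp add: field_simps)
qed

text \<open>
  With \<open>w t = cform a (c t - x)\<close> and \<open>A = a \<bullet> (p - x)\<close>, the point \<open>A - w t\<close> moves in the right
  half-plane and \<open>Re (A - w t) \<le> \<bar>w t\<bar> + A\<close>, so the logarithmic derivative of \<open>\<bar>w t\<bar> + A\<close> is at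
  most twice the Kobayashi-Royden speed. The proof replaces \<open>\<bar>w t\<bar>\<close> by the smooth
  \<open>sqrt (\<bar>w t\<bar>\<^sup>2 + \<epsilon>\<^sup>2)\<close>.
\<close>
lemma curve_length_halfplane:
  fixes \<Omega> :: "(complex^'n) set"
  assumes \<Omega>: "open \<Omega>" and sep: "\<And>z. z \<in> \<Omega> \<Longrightarrow> a \<bullet> z < a \<bullet> p"
    and L: "L \<in> curve_lengths \<Omega> (kobayashi_royden \<Omega>) x y"
  shows "cmod (cform a (y - x)) \<le> (exp (2 * L) - 1) * (a \<bullet> (p - x))"
proof -
  obtain c where c: "c piecewise_differentiable_on {0..1}" "c ` {0..1} \<subseteq> \<Omega>" "c 0 = x" "c 1 = y"
    and int: "((\<lambda>t. kobayashi_royden \<Omega> (c t) (vector_derivative c (at t))) has_integral L) {0..1}"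
    using L by (auto simp: curve_lengths_def)
  obtain S where S: "finite S" "\<And>t. t \<in> {0..1} - S \<Longrightarrow> c differentiable (at t within {0..1})"
    using c(1) by (auto simp: piecewise_differentiable_on_def)
  define A where "A = a \<bullet> (p - x)"
  have "x \<in> \<Omega>"
    using c(2,3) by auto
  then have A: "A > 0"
    using sep[of x] by (simp add: A_def inner_diff_right)
  define w where "w t = cform a (c t - x)" for t
  have contw: "continuous_on {0..1} w"
    unfolding w_def
    by (intro linear_continuous_on_compose[OF _ linear_cform] continuous_intros
        piecewise_differentiable_on_imp_continuous_on c(1))
  have main: "cmod (w 1) + A \<le> (\<epsilon> + A) * exp (2 * L)" if "\<epsilon> > 0" for \<epsilon>
  proof -
    define s where "s t = sqrt (w t \<bullet> w t + \<epsilon>\<^sup>2)" for t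
    have s0: "w t \<bullet> w t + \<epsilon>\<^sup>2 > 0" for t
      using that by (simp add: add_nonneg_pos)
    have s: "s t > 0" "cmod (w t) \<le> s t" for t
      using s0[of t] by (auto simp: s_def norm_eq_sqrt_inner)
    define w' where "w' t = cform a (vector_derivative c (at t))" for t
    \<comment> \<open>The integrand is the derivative of \<open>ln (s t + A)\<close>. This form of
      the fundamental theorem needs only continuity at the finitely many times in \<open>S\<close>
      and at the endpoints.\<close>
    have "((\<lambda>t. (w t \<bullet> w' t) / s t / (s t + A)) has_integral ln (s 1 + A) - ln (s 0 + A)) {0..1}"
    proof (rule fundamental_theorem_of_calculus_interior_strong[OF S(1)])
      show "continuous_on {0..1} (\<lambda>t. ln (s t + A))"
        unfolding s_def using s(1) A s0 that
        by (intro continuous_intros contw) (auto simp: add_nonneg_pos less_imp_neq[symmetric] add_pos_pos)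
      fix t :: real assume t: "t \<in> {0<..<1} - S"
      have "c differentiable (at t)"
        using S(2)[of t] t by (auto simp: at_within_Icc_at)
      then have "(c has_vector_derivative vector_derivative c (at t)) (at t)"
        by (simp add: vector_derivative_works)
      then have "((\<lambda>t. c t - x) has_vector_derivative vector_derivative c (at t)) (at t)"
        by (auto intro!: derivative_eq_intros)
      then have w': "(w has_vector_derivative w' t) (at t)"
        unfolding w_def w'_def
        by (rule bounded_linear.has_vector_derivative[OF linear_conv_bounded_linear[THEN iffD1, OF linear_cform]])
      have "((\<lambda>t. w t \<bullet> w t + \<epsilon>\<^sup>2) has_vector_derivative 2 * (w t \<bullet> w' t)) (at t)"
        by (rule derivative_eq_intros w' bounded_bilinear.has_vector_derivative[OF bounded_bilinear_inner] refl)+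
           (simp add: inner_commute)
      then have "((\<lambda>t. w t \<bullet> w t + \<epsilon>\<^sup>2) has_real_derivative 2 * (w t \<bullet> w' t)) (at t)"
        by (simp add: has_real_derivative_iff_has_vector_derivative)
      from DERIV_chain2[OF DERIV_real_sqrt[OF s0] this]
      have "(s has_real_derivative (w t \<bullet> w' t) / s t) (at t)"
        by (simp add: s_def[abs_def] field_simps)
      then have "((\<lambda>t. ln (s t + A)) has_real_derivative (w t \<bullet> w' t) / s t / (s t + A)) (at t)"
        using s(1)[of t] A by (auto intro!: derivative_eq_intros add_pos_pos)
      then show "((\<lambda>t. ln (s t + A)) has_vector_derivative (w t \<bullet> w' t) / s t / (s t + A)) (at t)"
        by (simp add: has_real_derivative_iff_has_vector_derivative)
    qed simp
    then have "ln (s 1 + A) - ln (s 0 + A) \<le> 2 * L"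
    proof (rule has_integral_le)
      show "((\<lambda>t. 2 * kobayashi_royden \<Omega> (c t) (vector_derivative c (at t))) has_integral 2 * L) {0..1}"
        using int by (rule has_integral_mult_right)
      fix t :: real assume "t \<in> {0..1}"
      then have ct: "c t \<in> \<Omega>"
        using c(2) by auto
      let ?K = "kobayashi_royden \<Omega> (c t) (vector_derivative c (at t))"
      have "a \<bullet> (p - c t) = A - Re (w t)"
        by (simp add: A_def w_def Re_cform inner_diff_right)
      also have "\<dots> \<le> s t + A"
        using abs_Re_le_cmod[of "w t"] s(2)[of t] by linarith
      finally have le: "a \<bullet> (p - c t) \<le> s t + A" .
      have pos: "a \<bullet> (p - c t) > 0"
        using sep[OF ct] by (simp add: inner_diff_right)
      have w': "cmod (w' t) \<le> 2 * (a \<bullet> (p - c t)) * ?K"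
        unfolding w'_def by (rule kobayashi_royden_ge[OF \<Omega> ct sep])
      \<comment> \<open>No metric axiom is at hand here, so nonnegativity of \<open>?K\<close> is
        read off from the lower bound.\<close>
      then have "0 \<le> (2 * (a \<bullet> (p - c t))) * ?K"
        by (rule order_trans[OF norm_ge_zero])
      then have K: "?K \<ge> 0"
        using pos by (simp add: zero_le_mult_iff)
      have "w t \<bullet> w' t \<le> cmod (w t) * cmod (w' t)"
        by (rule norm_cauchy_schwarz)
      also have "\<dots> \<le> s t * cmod (w' t)"
        using s by (intro mult_right_mono) auto
      finally have "(w t \<bullet> w' t) / s t \<le> cmod (w' t)"
        using s(1)[of t] by (simp add: field_simps)
      also have "\<dots> \<le> (2 * ?K) * (s t + A)"
        using w' mult_left_mono[OF le K] by (simp add: mult_ac)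
      finally show "(w t \<bullet> w' t) / s t / (s t + A) \<le> 2 * ?K"
        using s(1)[of t] A by (subst pos_divide_le_eq) auto
    qed
    moreover have "w 0 = 0"
      by (simp add: w_def c(3) linear_0[OF linear_cform])
    then have "s 0 = \<epsilon>"
      using that by (simp add: s_def)
    ultimately have "ln (s 1 + A) \<le> ln (\<epsilon> + A) + 2 * L"
      by simp
    then have "exp (ln (s 1 + A)) \<le> exp (ln (\<epsilon> + A) + 2 * L)"
      by (simp only: exp_le_cancel_iff)
    then have "s 1 + A \<le> (\<epsilon> + A) * exp (2 * L)"
      using s(1)[of 1] A that by (simp add: exp_add)
    then show ?thesis
      using s(2)[of 1] by simp
  qed
  \<comment> \<open>Let \<epsilon> tend to 0: the choice \<open>e / exp (2 * L)\<close> makes the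
    excess exactly \<open>e\<close>.\<close>
  have "cmod (w 1) + A \<le> A * exp (2 * L)"
  proof (rule field_le_epsilon)
    fix e :: real assume "e > 0"
    then show "cmod (w 1) + A \<le> A * exp (2 * L) + e"
      using main[of "e / exp (2 * L)"] by (simp add: distrib_right add.commute)
  qed
  then show ?thesis
    by (simp add: w_def c(4) A_def algebra_simps)
qed

section \<open>Curves and their lengths for a general metric\<close>

lemma finsler_metricD:
  assumes "finsler_metric \<Omega> F" "x \<in> \<Omega>"
  shows finsler_metric_nonneg: "F x v \<ge> 0"
    and finsler_metric_eq_0: "F x v = 0 \<Longrightarrow> v = 0"
    and finsler_metric_scale: "F x (c *s v) = cmod c * F x v"
  using assms by (auto simp: finsler_metric_def)

lemma finsler_metric_scaleR:
  assumes "finsler_metric \<Omega> F" "x \<in> \<Omega>"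
  shows "F x (r *\<^sub>R v) = \<bar>r\<bar> * F x v"
  using finsler_metric_scale[OF assms, of "of_real r" v] by (simp add: scaleR_eq_scale)

lemma curve_lengthsI:
  assumes "c piecewise_differentiable_on {0..1}" "c ` {0..1} \<subseteq> \<Omega>" "c 0 = x" "c 1 = y"
    "((\<lambda>t. F (c t) (vector_derivative c (at t))) has_integral L) {0..1}"
  shows "L \<in> curve_lengths \<Omega> F x y"
  unfolding curve_lengths_def mem_Collect_eq by (rule exI[of _ c]) (intro conjI assms)

lemma curve_lengths_nonneg:
  assumes "finsler_metric \<Omega> F" "L \<in> curve_lengths \<Omega> F x y"
  shows "L \<ge> 0"
proof -
  obtain c where c: "c ` {0..1} \<subseteq> \<Omega>"
    "((\<lambda>t. F (c t) (vector_derivative c (at t))) has_integral L) {0..1}"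
    using assms by (auto simp: curve_lengths_def)
  from c(2) show ?thesis
  proof (rule has_integral_nonneg)
    fix t :: real assume "t \<in> {0..1}"
    then show "0 \<le> F (c t) (vector_derivative c (at t))"
      using c(1) by (intro finsler_metric_nonneg[OF assms(1)]) blast
  qed
qed

text \<open>Traversing the curve backwards negates its velocity, which \<open>F\<close> does not
  see. This yields the symmetry of the distance.\<close>

lemma curve_lengths_reverse:
  assumes F: "finsler_metric \<Omega> F" and L: "L \<in> curve_lengths \<Omega> F x y"
  shows "L \<in> curve_lengths \<Omega> F y x"
proof -
  obtain c where c: "c piecewise_differentiable_on {0..1}" "c ` {0..1} \<subseteq> \<Omega>" "c 0 = x" "c 1 = y"
    and int: "((\<lambda>t. F (c t) (vector_derivative c (at t))) has_integral L) {0..1}"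
    using L by (auto simp: curve_lengths_def)
  obtain S where S: "finite S" "\<And>t. t \<in> {0..1} - S \<Longrightarrow> c differentiable (at t within {0..1})"
    using c(1) by (auto simp: piecewise_differentiable_on_def)
  define e where "e t = c (1 - t)" for t
  have "(\<lambda>t::real. (-1) *\<^sub>R t + 1) ` {0..1} = {0..1}"
    by (simp add: image_affinity_atLeastAtMost_div_diff image_affinity_atLeastAtMost)
  then have "(c \<circ> (\<lambda>t. (-1) *\<^sub>R t + 1)) piecewise_differentiable_on {0..1}"
    using c(1) by (intro piecewise_differentiable_affine) simp
  moreover have "c \<circ> (\<lambda>t. (-1) *\<^sub>R t + 1) = e"
    by (simp add: e_def fun_eq_iff)
  ultimately have e: "e piecewise_differentiable_on {0..1}"
    by simp
  \<comment> \<open>The endpoints are excluded because the two-sided derivative there involves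
    values of \<open>c\<close> outside the unit interval.\<close>
  have der: "vector_derivative e (at t) = - vector_derivative c (at (1 - t))"
    if t: "t \<in> {0..1} - ({0,1} \<union> (\<lambda>t. 1 - t) ` S)" for t
  proof (rule vector_derivative_at)
    have "1 - t \<in> {0..1} - S"
      using t by force
    then have "c differentiable at (1 - t)"
      using S(2)[of "1 - t"] t by (auto simp: at_within_Icc_at)
    then have "(c has_vector_derivative vector_derivative c (at (1 - t))) (at (1 - t))"
      by (simp add: vector_derivative_works)
    moreover have "((\<lambda>t::real. 1 - t) has_vector_derivative -1) (at t)"
      by (auto intro!: derivative_eq_intros)
    ultimately show "(e has_vector_derivative - vector_derivative c (at (1 - t))) (at t)"
      using vector_diff_chain_at[of "\<lambda>t. 1 - t" "-1" t c] by (simp add: o_def e_def[abs_def])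
  qed
  have "((\<lambda>t. F (c (1 - t)) (vector_derivative c (at (1 - t)))) has_integral L) {0..1}"
    using has_integral_affinity01[OF int, where m = "-1" and c = 1]
    by (simp add: image_affinity_atLeastAtMost_div_diff image_affinity_atLeastAtMost)
  then have "((\<lambda>t. F (e t) (vector_derivative e (at t))) has_integral L) {0..1}"
  proof (rule has_integral_spike_finite[rotated -1])
    show "finite ({0,1} \<union> (\<lambda>t. 1 - t) ` S)"
      using S(1) by simp
    fix t :: real assume t: "t \<in> {0..1} - ({0,1} \<union> (\<lambda>t. 1 - t) ` S)"
    then have "e t \<in> \<Omega>"
      using c(2) by (auto simp: e_def)
    then show "F (e t) (vector_derivative e (at t)) = F (c (1 - t)) (vector_derivative c (at (1 - t)))"
      using finsler_metric_scaleR[OF F, of "e t" "-1"] der[OF t] by (simp add: e_def)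
  qed
  moreover have "e ` {0..1} \<subseteq> \<Omega>"
  proof clarify
    fix t :: real assume "t \<in> {0..1}"
    then show "e t \<in> \<Omega>"
      using subsetD[OF c(2) imageI, of "1 - t"] by (simp add: e_def)
  qed
  ultimately show ?thesis
    by (intro curve_lengthsI[OF e]) (simp_all add: e_def c(3,4))
qed

text \<open>Each curve is run at double speed on half of the interval; by homogeneity of
  \<open>F\<close> the two effects cancel. This yields the triangle inequality.\<close>

lemma curve_lengths_join:
  assumes F: "finsler_metric \<Omega> F"
    and L1: "L1 \<in> curve_lengths \<Omega> F x y" and L2: "L2 \<in> curve_lengths \<Omega> F y z"
  shows "L1 + L2 \<in> curve_lengths \<Omega> F x z"
proof -
  obtain c1 where c1: "c1 piecewise_differentiable_on {0..1}" "c1 ` {0..1} \<subseteq> \<Omega>" "c1 0 = x" "c1 1 = y"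
    and int1: "((\<lambda>t. F (c1 t) (vector_derivative c1 (at t))) has_integral L1) {0..1}"
    using L1 by (auto simp: curve_lengths_def)
  obtain c2 where c2: "c2 piecewise_differentiable_on {0..1}" "c2 ` {0..1} \<subseteq> \<Omega>" "c2 0 = y" "c2 1 = z"
    and int2: "((\<lambda>t. F (c2 t) (vector_derivative c2 (at t))) has_integral L2) {0..1}"
    using L2 by (auto simp: curve_lengths_def)
  obtain S1 where S1: "finite S1" "\<And>t. t \<in> {0..1} - S1 \<Longrightarrow> c1 differentiable (at t within {0..1})"
    using c1(1) by (auto simp: piecewise_differentiable_on_def)
  obtain S2 where S2: "finite S2" "\<And>t. t \<in> {0..1} - S2 \<Longrightarrow> c2 differentiable (at t within {0..1})"
    using c2(1) by (auto simp: piecewise_differentiable_on_def)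
  define e where "e t = (if t \<le> 1/2 then c1 (2 * t) else c2 (2 * t - 1))" for t
  have "(c1 \<circ> (\<lambda>t. 2 *\<^sub>R t + 0)) piecewise_differentiable_on {0..1/2}"
    using c1(1) by (intro piecewise_differentiable_affine)
      (simp add: image_affinity_atLeastAtMost_div_diff image_affinity_atLeastAtMost)
  moreover have "(c2 \<circ> (\<lambda>t. 2 *\<^sub>R t + (-1))) piecewise_differentiable_on {1/2..1}"
    using c2(1) image_affinity_atLeastAtMost[of 2 "-1" "1/2" "1 :: real"]
    by (intro piecewise_differentiable_affine) simp
  moreover have "e = (\<lambda>t. if t \<le> 1/2 then (c1 \<circ> (\<lambda>t. 2 *\<^sub>R t + 0)) t else (c2 \<circ> (\<lambda>t. 2 *\<^sub>R t + (-1))) t)"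
    by (simp add: e_def fun_eq_iff)
  ultimately have e: "e piecewise_differentiable_on {0..1}"
    using c1(4) c2(3) piecewise_differentiable_cases[of "c1 \<circ> (\<lambda>t. 2 *\<^sub>R t + 0)" 0 "1/2"
      "c2 \<circ> (\<lambda>t. 2 *\<^sub>R t + (-1))" 1] by simp
  have e_image: "e ` {0..1} \<subseteq> \<Omega>"
  proof clarify
    fix t :: real assume "t \<in> {0..1}"
    then show "e t \<in> \<Omega>"
      using subsetD[OF c1(2) imageI, of "2 * t"] subsetD[OF c2(2) imageI, of "2 * t - 1"]
      by (auto simp: e_def)
  qed
  have i1: "((\<lambda>t. 2 *\<^sub>R F (c1 (2 * t)) (vector_derivative c1 (at (2 * t)))) has_integral L1) {0..1/2}"
    using has_integral_affinity01[OF int1, where m = 2 and c = 0, THEN has_integral_cmul[where c = 2]]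
    by (simp add: image_affinity_atLeastAtMost_div_diff image_affinity_atLeastAtMost_div)
  have i2: "((\<lambda>t. 2 *\<^sub>R F (c2 (2 * t - 1)) (vector_derivative c2 (at (2 * t - 1)))) has_integral L2) {1/2..1}"
    using has_integral_affinity01[OF int2, where m = 2 and c = "-1", THEN has_integral_cmul[where c = 2]]
    by (simp only: image_affinity_atLeastAtMost_div_diff) simp
  \<comment> \<open>Besides the rescaled exceptional times, the endpoint 0 and the junction
    \<open>1/2\<close> are left out: at these \<open>e\<close> need not agree with a differentiable
    curve on both sides.\<close>
  have der1: "vector_derivative e (at t) = 2 *\<^sub>R vector_derivative c1 (at (2 * t))"
    if t: "t \<in> {0..1/2} - ({0,1/2} \<union> (\<lambda>t. t / 2) ` S1)" for t
  proof (rule vector_derivative_at[OF has_vector_derivative_transform_within_open])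
    show "t \<in> {..<1/2}" "open {..<1/2 :: real}"
      using t by auto
    show "c1 (2 * u) = e u" if "u \<in> {..<1/2}" for u
      using that by (simp add: e_def)
    have "2 * t \<in> {0..1} - S1"
      using t image_eqI[of t "\<lambda>t. t / 2" "2 * t" S1] by auto
    then have "c1 differentiable at (2 * t)"
      using S1(2)[of "2 * t"] t by (auto simp: at_within_Icc_at)
    then have "(c1 has_vector_derivative vector_derivative c1 (at (2 * t))) (at (2 * t))"
      by (simp add: vector_derivative_works)
    moreover have "((\<lambda>t::real. 2 * t) has_vector_derivative 2) (at t)"
      by (auto intro!: derivative_eq_intros)
    ultimately show "((\<lambda>u. c1 (2 * u)) has_vector_derivative 2 *\<^sub>R vector_derivative c1 (at (2 * t))) (at t)"
      using vector_diff_chain_at[of "\<lambda>t. 2 * t" 2 t c1] by (simp add: o_def)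
  qed
  have der2: "vector_derivative e (at t) = 2 *\<^sub>R vector_derivative c2 (at (2 * t - 1))"
    if t: "t \<in> {1/2..1} - ({1/2,1} \<union> (\<lambda>t. (t + 1) / 2) ` S2)" for t
  proof (rule vector_derivative_at[OF has_vector_derivative_transform_within_open])
    show "t \<in> {1/2<..}" "open {1/2 :: real<..}"
      using t by auto
    show "c2 (2 * u - 1) = e u" if "u \<in> {1/2<..}" for u
      using that by (simp add: e_def)
    have "2 * t - 1 \<in> {0..1} - S2"
      using t image_eqI[of t "\<lambda>t. (t + 1) / 2" "2 * t - 1" S2] by auto
    then have "c2 differentiable at (2 * t - 1)"
      using S2(2)[of "2 * t - 1"] t by (auto simp: at_within_Icc_at)
    then have "(c2 has_vector_derivative vector_derivative c2 (at (2 * t - 1))) (at (2 * t - 1))"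
      by (simp add: vector_derivative_works)
    moreover have "((\<lambda>t::real. 2 * t - 1) has_vector_derivative 2) (at t)"
      by (auto intro!: derivative_eq_intros)
    ultimately show "((\<lambda>u. c2 (2 * u - 1)) has_vector_derivative 2 *\<^sub>R vector_derivative c2 (at (2 * t - 1))) (at t)"
      using vector_diff_chain_at[of "\<lambda>t. 2 * t - 1" 2 t c2] by (simp add: o_def)
  qed
  have "((\<lambda>t. F (e t) (vector_derivative e (at t))) has_integral L1) {0..1/2}"
  proof (rule has_integral_spike_finite[OF _ _ i1])
    show "finite ({0,1/2} \<union> (\<lambda>t. t / 2) ` S1)"
      using S1(1) by simp
    fix t :: real assume t: "t \<in> {0..1/2} - ({0,1/2} \<union> (\<lambda>t. t / 2) ` S1)"
    then have "e t = c1 (2 * t)" "e t \<in> \<Omega>"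
      using e_image by (auto simp: e_def)
    then show "F (e t) (vector_derivative e (at t)) = 2 *\<^sub>R F (c1 (2 * t)) (vector_derivative c1 (at (2 * t)))"
      by (simp add: der1[OF t] finsler_metric_scaleR[OF F])
  qed
  moreover have "((\<lambda>t. F (e t) (vector_derivative e (at t))) has_integral L2) {1/2..1}"
  proof (rule has_integral_spike_finite[OF _ _ i2])
    show "finite ({1/2,1} \<union> (\<lambda>t. (t + 1) / 2) ` S2)"
      using S2(1) by simp
    fix t :: real assume t: "t \<in> {1/2..1} - ({1/2,1} \<union> (\<lambda>t. (t + 1) / 2) ` S2)"
    then have "e t = c2 (2 * t - 1)" "e t \<in> \<Omega>"
      using e_image by (auto simp: e_def)
    then show "F (e t) (vector_derivative e (at t)) = 2 *\<^sub>R F (c2 (2 * t - 1)) (vector_derivative c2 (at (2 * t - 1)))"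
      by (simp add: der2[OF t] finsler_metric_scaleR[OF F])
  qed
  ultimately have "((\<lambda>t. F (e t) (vector_derivative e (at t))) has_integral L1 + L2) {0..1}"
    by (intro has_integral_combine[of 0 "1/2" 1]) auto
  then show ?thesis
    by (rule curve_lengthsI[OF e e_image, rotated 2]) (simp_all add: e_def c1(3) c2(4))
qed

text \<open>The integrand along a segment need not be continuous. Upper semicontinuity of
  \<open>F\<close> makes its strict sublevel sets relatively open, hence it is measurable, and being
  bounded it is integrable.\<close>

lemma segment_length:
  fixes \<Omega> :: "(complex^'n) set"
  assumes F: "finsler_metric \<Omega> F"
    and seg: "closed_segment x y \<subseteq> \<Omega>"
    and bound: "\<And>z. z \<in> closed_segment x y \<Longrightarrow> F z (y - x) \<le> B"
  shows "\<exists>L \<in> curve_lengths \<Omega> F x y. L \<le> B"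
proof -
  define c where "c = linepath x y"
  have c_in: "c t \<in> closed_segment x y" if "t \<in> {0..1}" for t
    using that linepath_in_path[of t x y] by (simp add: c_def)
  have c': "vector_derivative c (at t) = y - x" for t
    by (simp add: c_def vector_derivative_linepath_at)
  define f where "f t = F (c t) (y - x)" for t
  have cont: "continuous_on UNIV c"
    unfolding c_def by (intro continuous_on_linepath)
  have "f \<in> borel_measurable (lebesgue_on {0..1})"
  proof (rule borel_measurableI_less)
    fix a
    define U where "U = {t \<in> {0..1}. f t < a}"
    have "openin (top_of_set {0..1}) U"
    proof (subst openin_subopen, clarify)
      fix t assume "t \<in> U"
      then have t: "t \<in> {0..1}" "F (c t) (y - x) < a" "c t \<in> \<Omega>"
        using c_in[of t] seg by (auto simp: U_def f_def)
      with F have ev: "\<forall>\<^sub>F p in at (c t, y - x) within \<Omega> \<times> UNIV. F (fst p) (snd p) < a"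
        by (auto simp: finsler_metric_def)
      then obtain V where V: "open V" "(c t, y - x) \<in> V"
        "\<And>p. p \<in> V \<Longrightarrow> p \<noteq> (c t, y - x) \<Longrightarrow> p \<in> \<Omega> \<times> UNIV \<Longrightarrow> F (fst p) (snd p) < a"
        unfolding eventually_at_topological by blast
      define W where "W = (\<lambda>u. (c u, y - x)) -` V"
      have "open W"
        unfolding W_def using cont V(1)
        by (intro open_vimage continuous_intros) auto
      moreover have "t \<in> W"
        using V(2) by (simp add: W_def)
      moreover have "{0..1} \<inter> W \<subseteq> U"
      proof
        fix u assume u: "u \<in> {0..1} \<inter> W"
        then have "c u \<in> \<Omega>"
          using c_in seg by auto
        \<comment> \<open>The punctured neighbourhood says nothing about its centre; if
          \<open>c u = c t\<close>, the bound is the one assumed at \<open>t\<close>.\<close>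
        then have "F (c u) (y - x) < a"
          using V(3)[of "(c u, y - x)"] u t(2) by (cases "c u = c t") (simp_all add: W_def)
        then show "u \<in> U"
          using u by (simp add: U_def f_def)
      qed
      ultimately show "\<exists>T. openin (top_of_set {0..1}) T \<and> t \<in> T \<and> T \<subseteq> U"
        using t(1) by (intro exI[of _ "{0..1} \<inter> W"]) (auto intro: openin_open_Int)
    qed
    then obtain T where "open T" "U = {0..1} \<inter> T"
      by (auto simp: openin_open)
    moreover have "{t \<in> space (lebesgue_on {0..1}). f t < a} = U"
      by (auto simp: U_def space_restrict_space)
    ultimately show "{t \<in> space (lebesgue_on {0..1}). f t < a} \<in> sets (lebesgue_on {0..1})"
      by (auto simp: sets_restrict_space)
  qed
  moreover have bound': "norm (f t) \<le> B" if "t \<in> {0..1}" for t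
    using bound[OF c_in[OF that]] finsler_metric_nonneg[OF F subsetD[OF seg c_in[OF that]]]
    by (simp add: f_def)
  ultimately have "f integrable_on {0..1}"
    by (rule measurable_bounded_by_integrable_imp_integrable[OF _ integrable_const_ivl]) simp_all
  then obtain L where L: "(f has_integral L) {0..1}"
    by blast
  have "((\<lambda>_::real. B) has_integral B) {0..1}"
    using has_integral_const_real[of B 0 1] by simp
  then have "L \<le> B"
  proof (rule has_integral_le[OF L])
    show "f t \<le> B" if "t \<in> {0..1}" for t
      using bound'[OF that] by simp
  qed
  moreover have "L \<in> curve_lengths \<Omega> F x y"
  proof (rule curve_lengthsI)
    show "((\<lambda>t. F (c t) (vector_derivative c (at t))) has_integral L) {0..1}"
      using L unfolding f_def c' .
    show "c piecewise_differentiable_on {0..1}"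
      unfolding c_def linepath_def
      by (intro differentiable_imp_piecewise_differentiable derivative_intros)
    show "c ` {0..1} \<subseteq> \<Omega>"
      using c_in seg by blast
  qed (simp_all add: c_def linepath_def)
  ultimately show ?thesis
    by blast
qed

section \<open>Separation and the metric of a hyperbolic convex domain\<close>

text \<open>Strictness comes from openness: a point of \<Omega> can be moved a little in direction
  \<open>a\<close> without leaving \<Omega>, which strictly increases the functional.\<close>

lemma open_convex_separating:
  fixes \<Omega> :: "'a::euclidean_space set"
  assumes "open \<Omega>" "convex \<Omega>" "p \<notin> \<Omega>"
  obtains a where "\<And>z. z \<in> \<Omega> \<Longrightarrow> a \<bullet> z < a \<bullet> p"
proof (cases "\<Omega> = {}")
  case False
  then obtain a b where a: "a \<noteq> 0" "\<forall>z\<in>\<Omega>. a \<bullet> z \<le> b" "\<forall>z\<in>{p}. a \<bullet> z \<ge> b"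
    using separating_hyperplane_sets[of \<Omega> "{p}"] assms by auto
  show thesis
  proof (rule that)
    fix z assume "z \<in> \<Omega>"
    then obtain e where e: "e > 0" "ball z e \<subseteq> \<Omega>"
      using \<open>open \<Omega>\<close> openE by blast
    define z' where "z' = z + (e / 2 / norm a) *\<^sub>R a"
    have "z' \<in> \<Omega>"
      using e a(1) by (auto simp: z'_def dist_norm)
    then have "a \<bullet> z' \<le> a \<bullet> p"
      using a(2,3) by force
    moreover have "a \<bullet> z' > a \<bullet> z"
      using e(1) a(1) by (simp add: z'_def inner_add_right)
    ultimately show "a \<bullet> z < a \<bullet> p"
      by simp
  qed
qed (use that in auto)

locale hyperbolic_convex_domain =
  fixes \<Omega> :: "(complex^'n) set"
  assumes dom: "complex_domain \<Omega>" and conv: "convex \<Omega>" and hyp: "hyperbolic \<Omega>"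
begin

abbreviation K where "K \<equiv> kobayashi_royden \<Omega>"
abbreviation d where "d \<equiv> finsler_dist \<Omega> K"

lemma open_\<Omega>: "open \<Omega>"
  using dom by (simp add: complex_domain_def)

lemma finsler_K: "finsler_metric \<Omega> K"
  using hyp by (simp add: hyperbolic_def)

text \<open>A complex line inside \<Omega> would contain affine discs of every radius, forcing the
  metric to vanish in its direction.\<close>

lemma complex_line_leaves:
  assumes "x \<in> \<Omega>" "v \<noteq> 0"
  obtains \<zeta> where "x + \<zeta> *s v \<notin> \<Omega>"
proof (rule ccontr)
  assume "\<not> thesis"
  then have "\<And>\<zeta>. x + \<zeta> *s v \<in> \<Omega>"
    using that by blast
  then have le: "K x v \<le> 1 / R" if "R > 0" for R
    using kobayashi_royden_le[OF that] by blast
  have "K x v \<le> 0"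
  proof (rule field_le_epsilon)
    fix e :: real assume "e > 0"
    then show "K x v \<le> 0 + e"
      using le[of "1 / e"] by simp
  qed
  then have "K x v = 0"
    using finsler_metric_nonneg[OF finsler_K assms(1)] by (simp add: antisym)
  then show False
    using finsler_metric_eq_0[OF finsler_K assms(1)] assms(2) by blast
qed

text \<open>
  Every point \<open>p\<close> of the complex line through \<open>x\<close> and \<open>y\<close> that lies outside \<open>\<Omega>\<close> is tested
  against a hyperplane separating it from \<open>\<Omega>\<close>. The linear form cancels from the resulting
  inequality, which bounds the distance of \<open>p\<close> from \<open>x\<close> from below.
\<close>
lemma kobayashi_royden_le_curve_length:
  assumes L: "L \<in> curve_lengths \<Omega> K x y" and xy: "x \<in> \<Omega>" and M: "exp (2 * L) - 1 \<le> M" "M > 0"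
  shows "K x (y - x) \<le> M"
proof -
  define v where "v = y - x"
  \<comment> \<open>Working with \<open>M\<close> instead of \<open>exp (2 * L) - 1\<close> keeps
    the radius \<open>1 / M\<close> positive when \<open>L = 0\<close>.\<close>
  have "x + \<zeta> *s v \<in> \<Omega>" if \<zeta>: "cmod \<zeta> < 1 / M" for \<zeta>
  proof (rule ccontr)
    assume "x + \<zeta> *s v \<notin> \<Omega>"
    then obtain a where a: "\<And>z. z \<in> \<Omega> \<Longrightarrow> a \<bullet> z < a \<bullet> (x + \<zeta> *s v)"
      using open_convex_separating[OF open_\<Omega> conv] by blast
    have eq: "a \<bullet> (x + \<zeta> *s v - x) = Re (\<zeta> * cform a v)"
      by (simp add: Re_cform[symmetric] cform_scale)
    have pos: "Re (\<zeta> * cform a v) > 0"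
      using a[OF xy] eq by (simp add: inner_add_right)
    then have nz: "cform a v \<noteq> 0"
      by auto
    have "cmod (cform a v) \<le> (exp (2 * L) - 1) * Re (\<zeta> * cform a v)"
      using curve_length_halfplane[OF open_\<Omega> _ L, of a "x + \<zeta> *s v"] a
      unfolding v_def[symmetric] eq by blast
    also have "\<dots> \<le> M * Re (\<zeta> * cform a v)"
      using M pos by (intro mult_right_mono) auto
    also have "\<dots> \<le> M * (cmod \<zeta> * cmod (cform a v))"
      using M complex_Re_le_cmod[of "\<zeta> * cform a v"] by (simp add: norm_mult)
    finally have "1 \<le> M * cmod \<zeta>"
      using nz by simp
    then show False
      using \<zeta> M(2) by (simp add: field_simps)
  qed
  then show ?thesis
    using kobayashi_royden_le[of "1 / M" x v] M(2) by (simp add: v_def)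
qed

text \<open>Comparison with the Euclidean norm; it bounds the lengths of segments.\<close>

lemma kobayashi_royden_le_norm:
  assumes "ball z \<rho> \<subseteq> \<Omega>" "\<rho> > 0"
  shows "K z v \<le> norm v / \<rho>"
proof (cases "v = 0")
  case True
  have "z \<in> \<Omega>"
    using assms by auto
  then show ?thesis
    using finsler_metric_scale[OF finsler_K, of z 0 0] True by simp
next
  case False
  have "K z v \<le> 1 / (\<rho> / norm v)"
  proof (rule kobayashi_royden_le)
    show "\<rho> / norm v > 0"
      using assms(2) False by simp
    fix \<zeta> assume "cmod \<zeta> < \<rho> / norm v"
    then have "cmod \<zeta> * norm v < \<rho>"
      using False by (simp add: pos_less_divide_eq)
    then show "z + \<zeta> *s v \<in> \<Omega>"
      by (rule ball_complex_line[OF assms(1)])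
  qed
  then show ?thesis
    by simp
qed

section \<open>The induced distance is a metric\<close>

text \<open>By convexity the segment stays in \<Omega>, and by compactness one radius
  \<open>\<rho>\<close> serves all its points, so the metric is bounded along it.\<close>

lemma curve_lengths_nonempty:
  assumes "x \<in> \<Omega>" "y \<in> \<Omega>"
  shows "curve_lengths \<Omega> K x y \<noteq> {}"
proof -
  have seg: "closed_segment x y \<subseteq> \<Omega>"
    using assms conv by (simp add: closed_segment_subset)
  obtain \<rho> where \<rho>: "\<rho> > 0" "(\<Union>z\<in>closed_segment x y. ball z \<rho>) \<subseteq> \<Omega>"
    using compact_subset_open_imp_ball_epsilon_subset[OF compact_segment open_\<Omega> seg] by blast
  have "K z (y - x) \<le> norm (y - x) / \<rho>" if "z \<in> closed_segment x y" for z
    using \<rho> that by (intro kobayashi_royden_le_norm) auto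
  then show ?thesis
    using segment_length[OF finsler_K seg] by blast
qed

lemma dist_le:
  assumes "L \<in> curve_lengths \<Omega> K x y" "x \<in> \<Omega>" "y \<in> \<Omega>"
  shows "d x y \<le> L"
proof -
  have "bdd_below (curve_lengths \<Omega> K x y)"
    using curve_lengths_nonneg[OF finsler_K] by (intro bdd_belowI[of _ 0])
  then show ?thesis
    using assms by (simp add: finsler_dist_def cInf_lower)
qed

lemma dist_less_curve:
  assumes "d x y < r" "x \<in> \<Omega>" "y \<in> \<Omega>"
  obtains L where "L \<in> curve_lengths \<Omega> K x y" "L < r"
  using assms cInf_lessD[OF curve_lengths_nonempty[OF assms(2,3)]] by (auto simp: finsler_dist_def)

lemma dist_nonneg: "d x y \<ge> 0"
proof (cases "x \<in> \<Omega> \<and> y \<in> \<Omega>")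
  case True
  then have "Inf (curve_lengths \<Omega> K x y) \<ge> 0"
    using curve_lengths_nonneg[OF finsler_K] by (intro cInf_greatest curve_lengths_nonempty) auto
  then show ?thesis
    using True by (simp add: finsler_dist_def)
qed (auto simp: finsler_dist_def)

lemma dist_self:
  assumes "x \<in> \<Omega>"
  shows "d x x = 0"
proof -
  have "K z (x - x) \<le> 0" if "z \<in> closed_segment x x" for z
    using finsler_metric_scale[OF finsler_K assms, of 0 0] that by simp
  then obtain L where "L \<in> curve_lengths \<Omega> K x x" "L \<le> 0"
    using segment_length[OF finsler_K, of x x 0] assms by auto
  then show ?thesis
    using dist_le[OF _ assms assms] dist_nonneg[of x x] by (meson antisym order_trans)
qed

lemma kobayashi_royden_less_dist:
  assumes r: "d x y < r" and x: "x \<in> \<Omega>" and y: "y \<in> \<Omega>"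
  shows "K x (y - x) < exp (2 * r) - 1"
proof -
  obtain L where L: "L \<in> curve_lengths \<Omega> K x y" "L < r"
    using dist_less_curve[OF assms] .
  have "L \<ge> 0"
    using curve_lengths_nonneg[OF finsler_K L(1)] .
  \<comment> \<open>A value strictly between \<open>L\<close> and \<open>r\<close> gives a positive
    constant even if \<open>L = 0\<close> and leaves room for the strict inequality.\<close>
  define s where "s = (L + r) / 2"
  have s: "L < s" "s < r" "s > 0"
    using L(2) \<open>L \<ge> 0\<close> by (auto simp: s_def)
  have "K x (y - x) \<le> exp (2 * s) - 1"
    using s by (intro kobayashi_royden_le_curve_length[OF L(1) x]) auto
  also have "\<dots> < exp (2 * r) - 1"
    using s by simp
  finally show ?thesis .
qed

lemma eq_if_dist_0:
  assumes d0: "d x y = 0" and x: "x \<in> \<Omega>" and y: "y \<in> \<Omega>"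
  shows "x = y"
proof -
  have "K x (y - x) \<le> 0"
  proof (rule field_le_epsilon)
    fix e :: real assume "e > 0"
    \<comment> \<open>The radius is chosen so that \<open>exp (2 * r) - 1 = e\<close>.\<close>
    then show "K x (y - x) \<le> 0 + e"
      using kobayashi_royden_less_dist[OF _ x y, of "ln (1 + e) / 2"] d0 by simp
  qed
  then have "K x (y - x) = 0"
    using finsler_metric_nonneg[OF finsler_K x] by (simp add: antisym)
  then show ?thesis
    using finsler_metric_eq_0[OF finsler_K x] by force
qed

lemma dist_commute_le:
  assumes "x \<in> \<Omega>" "y \<in> \<Omega>"
  shows "d x y \<le> d y x"
proof (rule field_le_epsilon)
  fix e :: real assume "e > 0"
  then obtain L where "L \<in> curve_lengths \<Omega> K y x" "L < d y x + e"
    using dist_less_curve[of y x "d y x + e"] assms by auto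
  then show "d x y \<le> d y x + e"
    using dist_le[OF curve_lengths_reverse[OF finsler_K]] assms by fastforce
qed

lemma dist_triangle:
  assumes "x \<in> \<Omega>" "y \<in> \<Omega>" "z \<in> \<Omega>"
  shows "d x z \<le> d x y + d y z"
proof (rule field_le_epsilon)
  fix e :: real assume e: "e > 0"
  obtain L1 where L1: "L1 \<in> curve_lengths \<Omega> K x y" "L1 < d x y + e / 2"
    using dist_less_curve[of x y "d x y + e / 2"] assms e by auto
  obtain L2 where L2: "L2 \<in> curve_lengths \<Omega> K y z" "L2 < d y z + e / 2"
    using dist_less_curve[of y z "d y z + e / 2"] assms e by auto
  show "d x z \<le> d x y + d y z + e"
    using dist_le[OF curve_lengths_join[OF finsler_K L1(1) L2(1)]] assms L1(2) L2(2) by simp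
qed

sublocale Metric_space \<Omega> d
proof
  \<comment> \<open>Symmetry is required for all points; unless both lie in \<Omega>, both sides are
    0 by convention.\<close>
  show "d x y = d y x" for x y
    using dist_commute_le[of x y] dist_commute_le[of y x]
    by (cases "x \<in> \<Omega> \<and> y \<in> \<Omega>") (auto simp: finsler_dist_def)
  show "d x y = 0 \<longleftrightarrow> x = y" if "x \<in> \<Omega>" "y \<in> \<Omega>" for x y
    using eq_if_dist_0 dist_self that by blast
qed (auto intro: dist_nonneg dist_triangle)

section \<open>Cauchy completeness\<close>

lemma cform_dist:
  assumes r: "d x y < r" and xy: "x \<in> \<Omega>" "y \<in> \<Omega>" and sep: "\<And>z. z \<in> \<Omega> \<Longrightarrow> a \<bullet> z < a \<bullet> p"
  shows "cmod (cform a (y - x)) \<le> (exp (2 * r) - 1) * (a \<bullet> (p - x))"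
proof -
  obtain L where L: "L \<in> curve_lengths \<Omega> K x y" "L < r"
    using dist_less_curve[OF r xy] .
  have "cmod (cform a (y - x)) \<le> (exp (2 * L) - 1) * (a \<bullet> (p - x))"
    by (rule curve_length_halfplane[OF open_\<Omega> sep L(1)])
  also have "\<dots> \<le> (exp (2 * r) - 1) * (a \<bullet> (p - x))"
    using L(2) sep[OF xy(1)] by (intro mult_right_mono) (auto simp: inner_diff_right)
  finally show ?thesis .
qed

text \<open>The increments are at most \<open>exp (2 * r) - 1\<close> times
  \<open>a \<bullet> (p - \<sigma> m)\<close>. The latter stays bounded on a tail, while the former
  becomes arbitrarily small.\<close>

lemma Cauchy_cform:
  assumes \<sigma>: "MCauchy \<sigma>" and sep: "\<And>z. z \<in> \<Omega> \<Longrightarrow> a \<bullet> z < a \<bullet> p"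
  shows "Cauchy (\<lambda>m. cform a (\<sigma> m))"
proof (rule CauchyI')
  fix e :: real assume e: "e > 0"
  have in\<Omega>: "\<sigma> m \<in> \<Omega>" for m
    using \<sigma> by (auto simp: MCauchy_def)
  \<comment> \<open>At radius \<open>ln 2 / 2\<close> the factor \<open>exp (2 * r) - 1\<close> is
    1, so \<open>a \<bullet> (p - \<sigma> m)\<close> at most doubles beyond \<open>N\<close>; hence
    the 2 in \<open>B\<close>.\<close>
  obtain N where N: "\<And>m n. N \<le> m \<Longrightarrow> N \<le> n \<Longrightarrow> d (\<sigma> m) (\<sigma> n) < ln 2 / 2"
    using \<sigma> unfolding MCauchy_def by (metis ln_gt_zero half_gt_zero one_less_numeral_iff semiring_norm(76))
  define B where "B = 2 * (a \<bullet> (p - \<sigma> N))"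
  have B: "B > 0"
    using sep[OF in\<Omega>, of N] by (simp add: B_def inner_diff_right)
  have le: "a \<bullet> (p - \<sigma> m) \<le> B" if "m \<ge> N" for m
  proof -
    have "cmod (cform a (\<sigma> m - \<sigma> N)) \<le> a \<bullet> (p - \<sigma> N)"
      using cform_dist[OF N[OF order.refl that] in\<Omega> in\<Omega> sep] by simp
    moreover have "\<bar>a \<bullet> (\<sigma> m - \<sigma> N)\<bar> \<le> cmod (cform a (\<sigma> m - \<sigma> N))"
      using abs_Re_le_cmod by (simp add: Re_cform[symmetric])
    ultimately show ?thesis
      by (simp add: B_def inner_diff_right)
  qed
  \<comment> \<open>Chosen so that the increments are at most \<open>e / 2\<close>, which is
    strictly below \<open>e\<close>.\<close>
  define r where "r = ln (1 + e / (2 * B)) / 2"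
  have "1 < 1 + e / (2 * B)"
    using e B by simp
  then have "r > 0"
    unfolding r_def by (intro half_gt_zero ln_gt_zero)
  then obtain N' where N': "\<And>m n. N' \<le> m \<Longrightarrow> N' \<le> n \<Longrightarrow> d (\<sigma> m) (\<sigma> n) < r"
    using \<sigma> unfolding MCauchy_def by metis
  have r: "exp (2 * r) - 1 = e / (2 * B)"
    using e B by (simp add: r_def add_pos_pos)
  have "dist (cform a (\<sigma> m)) (cform a (\<sigma> n)) < e" if m: "m \<ge> max N N'" and n: "n > m" for m n
  proof -
    have "dist (cform a (\<sigma> m)) (cform a (\<sigma> n)) = cmod (cform a (\<sigma> n - \<sigma> m))"
      by (simp add: cform_diff dist_norm norm_minus_commute)
    also have "\<dots> \<le> e / (2 * B) * (a \<bullet> (p - \<sigma> m))"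
      using cform_dist[OF N' in\<Omega> in\<Omega> sep, of m n] m n by (simp add: r)
    also have "\<dots> \<le> e / (2 * B) * B"
      using le[of m] m e B by (intro mult_left_mono) auto
    also have "\<dots> < e"
      using e B by simp
    finally show ?thesis .
  qed
  then show "\<exists>M. \<forall>m\<ge>M. \<forall>n>m. dist (cform a (\<sigma> m)) (cform a (\<sigma> n)) < e"
    by blast
qed

text \<open>Convergence here is Euclidean; the limit could still lie on the boundary, which
  \<open>MCauchy_limit_in\<close> excludes.\<close>

lemma MCauchy_imp_convergent:
  assumes \<sigma>: "MCauchy \<sigma>"
  shows "convergent \<sigma>"
proof -
  \<comment> \<open>A vector orthogonal to \<open>S\<close> is killed by the linear forms of all hyperplanes separating points
    from \<open>\<Omega>\<close>, so it spans a complex line inside \<open>\<Omega>\<close>, against hyperbolicity.\<close>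
  define S where "S = {a. convergent (\<lambda>m. a \<bullet> \<sigma> m)}"
  have "subspace S"
    unfolding subspace_def S_def
    by (auto simp: inner_add_left intro: convergent_add convergent_mult convergent_const)
  have "S = UNIV"
  proof (rule ccontr)
    assume "S \<noteq> UNIV"
    then have "span S \<subset> UNIV"
      using \<open>subspace S\<close> by (simp add: span_eq_iff[THEN iffD2] psubset_eq)
    then obtain v where v: "v \<noteq> 0" "\<And>a. a \<in> S \<Longrightarrow> orthogonal v a"
      using orthogonal_to_subspace_exists_gen[of S UNIV] span_superset by (metis span_UNIV subsetD)
    have x: "\<sigma> 0 \<in> \<Omega>"
      using \<sigma> by (auto simp: MCauchy_def)
    obtain \<zeta> where "\<sigma> 0 + \<zeta> *s v \<notin> \<Omega>"
      using complex_line_leaves[OF x v(1)] .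
    then obtain a where a: "\<And>z. z \<in> \<Omega> \<Longrightarrow> a \<bullet> z < a \<bullet> (\<sigma> 0 + \<zeta> *s v)"
      using open_convex_separating[OF open_\<Omega> conv] by blast
    obtain l where l: "(\<lambda>m. cform a (\<sigma> m)) \<longlonglongrightarrow> l"
      using Cauchy_cform[OF \<sigma> a] by (auto simp: Cauchy_convergent_iff convergent_def)
    \<comment> \<open>These two vectors represent the real and imaginary parts of
      \<open>cform a\<close>. Although \<open>S\<close> is only a real subspace, orthogonality to
      both kills the complex form at \<open>v\<close>.\<close>
    have "a \<in> S" "\<i> *s a \<in> S"
      using tendsto_Re[OF l] tendsto_Im[OF l] by (auto simp: S_def convergent_def Re_cform Im_cform)
    then have "cform a v = 0"
      using v(2)[of a] v(2)[of "\<i> *s a"] by (simp add: complex_eq_iff Re_cform Im_cform orthogonal_def inner_commute)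
    then have "a \<bullet> (\<zeta> *s v) = 0"
      by (simp add: Re_cform[symmetric] cform_scale)
    then show False
      using a[OF x] by (simp add: inner_add_right)
  qed
  then have "\<forall>b\<in>Basis. \<exists>l. (\<lambda>m. \<sigma> m \<bullet> b) \<longlonglongrightarrow> l"
    by (auto simp: S_def convergent_def inner_commute)
  then obtain l where "\<And>b. b \<in> Basis \<Longrightarrow> (\<lambda>m. \<sigma> m \<bullet> b) \<longlonglongrightarrow> l b"
    by metis
  then have "(\<lambda>m. \<Sum>b\<in>Basis. (\<sigma> m \<bullet> b) *\<^sub>R b) \<longlonglongrightarrow> (\<Sum>b\<in>Basis. l b *\<^sub>R b)"
    by (intro tendsto_intros)
  then show ?thesis
    by (auto simp: euclidean_representation convergent_def)
qed

lemma MCauchy_limit_in: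
  assumes \<sigma>: "MCauchy \<sigma>" and lim: "\<sigma> \<longlonglongrightarrow> x"
  shows "x \<in> \<Omega>"
proof (rule ccontr)
  assume "x \<notin> \<Omega>"
  then obtain a where a: "\<And>z. z \<in> \<Omega> \<Longrightarrow> a \<bullet> z < a \<bullet> x"
    using open_convex_separating[OF open_\<Omega> conv] by blast
  have in\<Omega>: "\<sigma> m \<in> \<Omega>" for m
    using \<sigma> by (auto simp: MCauchy_def)
  obtain N where N: "\<And>m n. N \<le> m \<Longrightarrow> N \<le> n \<Longrightarrow> d (\<sigma> m) (\<sigma> n) < 1"
    using \<sigma> unfolding MCauchy_def by (metis zero_less_one)
  \<comment> \<open>Applied with base point \<open>\<sigma> m\<close>, the half-plane estimate keeps the \<open>\<sigma> m\<close> away from the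
    hyperplane through \<open>x\<close>.\<close>
  have "a \<bullet> (\<sigma> m - \<sigma> N) \<le> (exp 2 - 1) * (a \<bullet> (x - \<sigma> m))" if "m \<ge> N" for m
  proof -
    have "a \<bullet> (\<sigma> m - \<sigma> N) \<le> cmod (cform a (\<sigma> N - \<sigma> m))"
      using complex_Re_le_cmod[of "cform a (\<sigma> m - \<sigma> N)"]
      by (simp add: Re_cform cform_diff inner_diff_right norm_minus_commute)
    also have "\<dots> \<le> (exp 2 - 1) * (a \<bullet> (x - \<sigma> m))"
      using cform_dist[OF N[OF that order.refl] in\<Omega> in\<Omega> a] by simp
    finally show ?thesis .
  qed
  moreover have "(\<lambda>m. a \<bullet> (\<sigma> m - \<sigma> N)) \<longlonglongrightarrow> a \<bullet> (x - \<sigma> N)"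
    by (intro tendsto_intros lim)
  moreover have "(\<lambda>m. (exp 2 - 1) * (a \<bullet> (x - \<sigma> m))) \<longlonglongrightarrow> (exp 2 - 1) * (a \<bullet> (x - x))"
    by (intro tendsto_intros lim)
  \<comment> \<open>The right-hand side is 0, whereas strict separation makes the left-hand side
    positive.\<close>
  ultimately have "a \<bullet> (x - \<sigma> N) \<le> (exp 2 - 1) * (a \<bullet> (x - x))"
    by (intro LIMSEQ_le) blast+
  then show False
    using a[OF in\<Omega>, of N] by (simp add: inner_diff_right)
qed

text \<open>Each point of the segment is within \<open>\<rho>\<close> of \<open>x\<close>, so its
  ball of radius \<open>\<rho>\<close> stays in \<Omega>. This turns Euclidean convergence inside
  \<Omega> into convergence for \<open>d\<close>.\<close>

lemma dist_le_norm:
  assumes "ball x (2 * \<rho>) \<subseteq> \<Omega>" "\<rho> > 0" "norm (y - x) < \<rho>"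
  shows "d y x \<le> norm (y - x) / \<rho>"
proof -
  have xy: "x \<in> \<Omega>" "y \<in> \<Omega>"
    using assms by (auto simp: dist_norm norm_minus_commute subset_iff)
  then have seg: "closed_segment y x \<subseteq> \<Omega>"
    using conv by (simp add: closed_segment_subset)
  have "K z (x - y) \<le> norm (y - x) / \<rho>" if z: "z \<in> closed_segment y x" for z
  proof -
    have "norm (z - x) \<le> norm (y - x)"
      using segment_bound(2)[OF z] by (simp add: norm_minus_commute)
    then have "ball z \<rho> \<subseteq> ball x (2 * \<rho>)"
      using assms(3) by (intro ball_subset_ball_iff[THEN iffD2]) (auto simp: dist_norm)
    then have "ball z \<rho> \<subseteq> \<Omega>"
      using assms(1) by blast
    then show ?thesis
      using kobayashi_royden_le_norm[OF _ assms(2), of z "x - y"] by (simp add: norm_minus_commute)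
  qed
  then obtain L where "L \<in> curve_lengths \<Omega> K y x" "L \<le> norm (y - x) / \<rho>"
    using segment_length[OF finsler_K seg] by blast
  then show ?thesis
    using dist_le xy by fastforce
qed

lemma mcomplete_kobayashi: "mcomplete"
  unfolding mcomplete_def
proof (intro allI impI)
  fix \<sigma> assume \<sigma>: "MCauchy \<sigma>"
  then obtain x where lim: "\<sigma> \<longlonglongrightarrow> x"
    using MCauchy_imp_convergent by (auto simp: convergent_def)
  have x: "x \<in> \<Omega>"
    by (rule MCauchy_limit_in[OF \<sigma> lim])
  have in\<Omega>: "\<sigma> m \<in> \<Omega>" for m
    using \<sigma> by (auto simp: MCauchy_def)
  obtain \<rho>' where "\<rho>' > 0" "ball x \<rho>' \<subseteq> \<Omega>"
    using x open_\<Omega> openE by blast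
  then obtain \<rho> where \<rho>: "\<rho> > 0" "ball x (2 * \<rho>) \<subseteq> \<Omega>"
    using that[of "\<rho>' / 2"] by auto
  have "\<forall>\<^sub>F m in sequentially. d (\<sigma> m) x < \<epsilon>" if "\<epsilon> > 0" for \<epsilon>
  proof -
    have "\<forall>\<^sub>F m in sequentially. dist (\<sigma> m) x < min \<rho> (\<epsilon> * \<rho>)"
      using lim \<rho>(1) that by (intro tendstoD) auto
    then show ?thesis
    proof eventually_elim
      case (elim m)
      then have *: "norm (\<sigma> m - x) < \<rho>" "norm (\<sigma> m - x) < \<epsilon> * \<rho>"
        by (auto simp: dist_norm)
      have "d (\<sigma> m) x \<le> norm (\<sigma> m - x) / \<rho>"
        by (rule dist_le_norm[OF \<rho>(2,1) *(1)])
      also have "\<dots> < \<epsilon>"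
        using *(2) \<rho>(1) by (simp add: pos_divide_less_eq)
      finally show ?case .
    qed
  qed
  then show "\<exists>x. limitin mtopology \<sigma> x sequentially"
    using x in\<Omega> by (auto simp: limitin_metric)
qed

section \<open>The inclusion of balls and its constant\<close>

lemma ball_subset_indicatrix:
  assumes r: "r > 0" and x: "x \<in> \<Omega>"
  shows "(\<lambda>y. y - x) ` finsler_ball \<Omega> K x r \<subseteq> (\<lambda>v. (exp (2 * r) - 1) *\<^sub>R v) ` indicatrix K x"
proof clarify
  fix y assume "y \<in> finsler_ball \<Omega> K x r"
  then have y: "y \<in> \<Omega>" "d x y < r"
    by (auto simp: finsler_ball_def)
  define M where "M = exp (2 * r) - 1"
  have M: "M > 0"
    using r by (simp add: M_def)
  have "K x (y - x) < M"
    unfolding M_def by (rule kobayashi_royden_less_dist[OF y(2) x y(1)])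
  then have "K x ((1 / M) *\<^sub>R (y - x)) < 1"
    using M unfolding finsler_metric_scaleR[OF finsler_K x] by simp
  then have "(1 / M) *\<^sub>R (y - x) \<in> indicatrix K x"
    by (simp add: indicatrix_def)
  moreover have "y - x = M *\<^sub>R ((1 / M) *\<^sub>R (y - x))"
    using M by simp
  ultimately show "y - x \<in> (\<lambda>v. (exp (2 * r) - 1) *\<^sub>R v) ` indicatrix K x"
    unfolding M_def by blast
qed

end

text \<open>With \<open>E = exp (2 * r)\<close>, \<open>tanh r = (E - 1) / (E + 1)\<close> and its
  complement to 1 is \<open>2 / (E + 1)\<close>. This matches the stated constant with the one from
  the half-plane estimate.\<close>

lemma two_lambda_H: "2 * lambda_H r = exp (2 * r) - 1"
proof -
  define E where "E = exp (2 * r)"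
  have E: "E > 0"
    by (simp add: E_def)
  have "exp (- 2 * r) = 1 / E"
    by (simp add: E_def exp_minus field_simps)
  then have "tanh r = (1 - 1 / E) / (1 + 1 / E)"
    unfolding tanh_real_altdef by simp
  also have "\<dots> = (E - 1) / (E + 1)"
    using E by (simp add: divide_simps)
  finally have tanh: "tanh r = (E - 1) / (E + 1)" .
  moreover have "1 - (E - 1) / (E + 1) = 2 / (E + 1)"
    using E by (simp add: field_simps)
  ultimately show ?thesis
    using E unfolding lambda_H_def E_def[symmetric] by simp
qed

theorem theorem2p8:
  fixes \<Omega> :: "(complex^'n) set"
  assumes "complex_domain \<Omega>" and "convex \<Omega>" and "hyperbolic \<Omega>"
  shows "uniformly_dominated \<Omega> (kobayashi_royden \<Omega>) \<and>
    (\<forall>r>0. \<forall>x\<in>\<Omega>.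
       (\<lambda>y. y - x) ` finsler_ball \<Omega> (kobayashi_royden \<Omega>) x r
         \<subseteq> (\<lambda>v. (2 * lambda_H r) *\<^sub>R v) ` indicatrix (kobayashi_royden \<Omega>) x)"
proof -
  interpret hyperbolic_convex_domain \<Omega>
    by unfold_locales (fact assms)+
  have sub: "\<forall>r>0. \<forall>x\<in>\<Omega>. (\<lambda>y. y - x) ` finsler_ball \<Omega> K x r
      \<subseteq> (\<lambda>v. (2 * lambda_H r) *\<^sub>R v) ` indicatrix K x"
    unfolding two_lambda_H using ball_subset_indicatrix by blast
  have "2 * lambda_H r > 0" if "r > 0" for r
    using that by (simp add: two_lambda_H)
  with sub have "uniformly_dominated \<Omega> K"
    unfolding uniformly_dominated_def
    using finsler_K Metric_space_axioms mcomplete_kobayashi by blast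
  with sub show ?thesis
    by blast
qed

end
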